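(* There is a constant $C>0$ such that for every positive integer $n$ there is a word $w$ over $[n]$ of length at most $C n^3$ that fixes every $n$-component monotone network.
   Context: An $n$-component (Boolean) network is a function $f=(f_1,\dots,f_n):\{0,1\}^n\to\{0,1\}^n$. Write $[n]=\{1,\dots,n\}$. For $i\in[n]$ and $x\in\{0,1\}^n$, $f^i(x):=(x_1,\dots,x_{i-1},f_i(x),x_{i+1},\dots,x_n)$. For a word $w=i_1i_2\dots i_k$ over the alphabet $[n]$, $f^w:=f^{i_k}\circ\cdots\circ f^{i_1}$ (and $f^\epsilon=\mathrm{id}$ for the empty word $\epsilon$). A word $w$ fixes $f$ if $f^w(x)$ is a fixed point of $f$ for every $x\in\{0,1\}^n$. The order on $\{0,1\}^n$ is componentwise: $x\le y$ iff $x_i\le y_i$ for all $i\in[n]$. The network $f$ is monotone if $x\le y$ implies $f(x)\le f(y)$ for all $x,y$. *)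

theory Defs
  imports Complex_Main "HOL-Library.FuncSet"
begin

text \<open>
  The cube \<open>{0,1}\<^sup>n\<close>, with \<open>False < True\<close> in the role of \<open>0 < 1\<close>. Configurations are extensional
  (equal to \<open>undefined\<close> off \<open>{1..n}\<close>), so on the cube equality and the pointwise order of
  functions are equality and order of the components \<open>1, \<dots>, n\<close>.
\<close>
definition cube :: "nat \<Rightarrow> (nat \<Rightarrow> bool) set" where
  "cube n = {1..n} \<rightarrow>\<^sub>E UNIV"

definition network :: "nat \<Rightarrow> ((nat \<Rightarrow> bool) \<Rightarrow> (nat \<Rightarrow> bool)) \<Rightarrow> bool" where
  "network n f \<longleftrightarrow> f \<in> cube n \<rightarrow> cube n"

definition monotone_network :: "nat \<Rightarrow> ((nat \<Rightarrow> bool) \<Rightarrow> (nat \<Rightarrow> bool)) \<Rightarrow> bool" where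
  "monotone_network n f \<longleftrightarrow> network n f \<and> mono_on (cube n) f"

definition update :: "((nat \<Rightarrow> bool) \<Rightarrow> (nat \<Rightarrow> bool)) \<Rightarrow> nat \<Rightarrow> (nat \<Rightarrow> bool) \<Rightarrow> (nat \<Rightarrow> bool)" where
  "update f i x = x(i := f x i)"

text \<open>The first letter of the word is applied first.\<close>
definition update_word ::
    "((nat \<Rightarrow> bool) \<Rightarrow> (nat \<Rightarrow> bool)) \<Rightarrow> nat list \<Rightarrow> (nat \<Rightarrow> bool) \<Rightarrow> (nat \<Rightarrow> bool)" where
  "update_word f w = fold (update f) w"

definition fixes_network :: "nat \<Rightarrow> nat list \<Rightarrow> ((nat \<Rightarrow> bool) \<Rightarrow> (nat \<Rightarrow> bool)) \<Rightarrow> bool" where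
  "fixes_network n w f \<longleftrightarrow> (\<forall>x \<in> cube n. f (update_word f w x) = update_word f w x)"

end

theory Submission
  imports Defs
begin

text \<open>
  Suppose that components \<open>1, \<dots>, m\<close> of the current configuration are stable, and let component
  \<open>m + 1\<close> be updated, to the value \<open>s\<close>. By monotonicity every component among \<open>1, \<dots>, m + 1\<close>
  that has value \<open>s\<close> now stays at \<open>s\<close>: from here on the first \<open>m + 1\<close> components can only move
  towards \<open>s\<close>. Hence every sweep \<open>1, \<dots>, m + 1\<close> that starts from a configuration unstable on these
  components sets a further one of them to \<open>s\<close>, and \<open>m + 1\<close> sweeps stabilise all of them. Starting from
  \<open>m = 0\<close>, this takes \<open>\<Sum>m=1..n. 1 + m\<^sup>2\<close> letters in all.
\<close>

text \<open>This is \<open>x \<le> y\<close> for \<open>s = True\<close> and \<open>y \<le> x\<close> for \<open>s = False\<close>, so one argument covers both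
  directions.\<close>
definition toward :: "bool \<Rightarrow> (nat \<Rightarrow> bool) \<Rightarrow> (nat \<Rightarrow> bool) \<Rightarrow> bool" where
  "toward s x y \<longleftrightarrow> (\<forall>i. x i = s \<longrightarrow> y i = s)"

text \<open>On \<open>S\<close> this is x \<le> f x for \<open>s = True\<close> and f x \<le> x for
  \<open>s = False\<close>.\<close>

definition persistent_on ::
    "nat set \<Rightarrow> bool \<Rightarrow> ((nat \<Rightarrow> bool) \<Rightarrow> (nat \<Rightarrow> bool)) \<Rightarrow> (nat \<Rightarrow> bool) \<Rightarrow> bool" where
  "persistent_on S s f x \<longleftrightarrow> (\<forall>i\<in>S. x i = s \<longrightarrow> f x i = s)"

definition stable_on ::
    "nat set \<Rightarrow> ((nat \<Rightarrow> bool) \<Rightarrow> (nat \<Rightarrow> bool)) \<Rightarrow> (nat \<Rightarrow> bool) \<Rightarrow> bool" where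
  "stable_on S f x \<longleftrightarrow> (\<forall>i\<in>S. f x i = x i)"

lemma update_word_Nil [simp]: "update_word f [] x = x"
  by (simp add: update_word_def)

lemma update_word_Cons [simp]:
  "update_word f (i # w) x = update_word f w (update f i x)"
  by (simp add: update_word_def)

lemma update_word_append [simp]:
  "update_word f (v @ w) x = update_word f w (update_word f v x)"
  by (simp add: update_word_def)

lemma update_in_cube:
  assumes "i \<in> {1..n}" "x \<in> cube n"
  shows "update f i x \<in> cube n"
  using assms by (auto simp: cube_def update_def PiE_iff extensional_def)

lemma update_word_in_cube:
  assumes "set w \<subseteq> {1..n}" "x \<in> cube n"
  shows "update_word f w x \<in> cube n"
  using assms by (induction w arbitrary: x) (auto simp: update_in_cube)

lemma update_word_stable:
  assumes "stable_on S f x" "set w \<subseteq> S"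
  shows "update_word f w x = x"
  using assms by (induction w) (auto simp: stable_on_def update_def)

lemma toward_trans: "toward s x y \<Longrightarrow> toward s y z \<Longrightarrow> toward s x z"
  by (simp add: toward_def)

lemma monotone_network_toward:
  assumes "monotone_network n f" "x \<in> cube n" "y \<in> cube n" "toward s x y"
  shows "toward s (f x) (f y)"
proof (cases s)
  case True
  then have "x \<le> y" using assms(4) by (auto simp: toward_def le_fun_def)
  then have "f x \<le> f y" using assms(1-3) by (auto simp: monotone_network_def mono_on_def)
  then show ?thesis using True by (auto simp: toward_def le_fun_def)
next
  case False
  then have "y \<le> x" using assms(4) by (auto simp: toward_def le_fun_def)
  then have "f y \<le> f x" using assms(1-3) by (auto simp: monotone_network_def mono_on_def)
  then show ?thesis using False by (auto simp: toward_def le_fun_def)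
qed

text \<open>A component of \<open>S\<close> that has value \<open>s\<close> after the update either
  had it before, or is \<open>a\<close> with \<open>f x a = s\<close>. Either way \<open>f x\<close>
  has value \<open>s\<close> there, and by monotonicity so does \<open>f\<close> at the updated
  configuration.\<close>

lemma persistent_update:
  assumes f: "monotone_network n f" and S: "S \<subseteq> {1..n}" "a \<in> S"
    and x: "x \<in> cube n" "persistent_on S s f x"
  shows "persistent_on S s f (update f a x)" "toward s x (update f a x)"
proof -
  show t: "toward s x (update f a x)"
    using S x unfolding toward_def persistent_on_def update_def by (metis fun_upd_apply)
  have "toward s (f x) (f (update f a x))"
    using S x by (intro monotone_network_toward[OF f] t update_in_cube) blast+
  then show "persistent_on S s f (update f a x)"
    using S x unfolding toward_def persistent_on_def update_def by (metis fun_upd_apply)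
qed

text \<open>The third conclusion gives the progress made by a sweep: as configurations move only
  toward \<open>s\<close>, a component that \<open>f\<close> sends to \<open>s\<close> at the start
  is still sent there when its letter is read, and then stays.\<close>

lemma persistent_update_word:
  assumes f: "monotone_network n f" and S: "S \<subseteq> {1..n}" "set w \<subseteq> S"
    and x: "x \<in> cube n" "persistent_on S s f x"
  shows "persistent_on S s f (update_word f w x)" "toward s x (update_word f w x)"
    "\<forall>i\<in>set w. f x i = s \<longrightarrow> update_word f w x i = s"
proof -
  have "persistent_on S s f (update_word f w x) \<and> toward s x (update_word f w x) \<and>
      (\<forall>i\<in>set w. f x i = s \<longrightarrow> update_word f w x i = s)"
    using S(2) x
  proof (induction w arbitrary: x)
    case Nil
    then show ?case by (simp add: toward_def)
  next
    case (Cons a w)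
    let ?x = "update f a x"
    have a: "a \<in> S" and w: "set w \<subseteq> S" using Cons.prems by auto
    note u = persistent_update[OF f S(1) a Cons.prems(2,3)]
    have c: "?x \<in> cube n" using a S(1) Cons.prems by (auto intro!: update_in_cube)
    note IH = Cons.IH[OF w c u(1)]
    have "toward s (f x) (f ?x)"
      by (rule monotone_network_toward[OF f Cons.prems(2) c u(2)])
    moreover have "f x a = s \<longrightarrow> ?x a = s" by (simp add: update_def)
    ultimately show ?case
      using IH u(2) toward_trans unfolding toward_def update_word_Cons list.set(2) by blast
  qed
  then show "persistent_on S s f (update_word f w x)" "toward s x (update_word f w x)"
    "\<forall>i\<in>set w. f x i = s \<longrightarrow> update_word f w x i = s" by auto
qed

lemma sweeps_stable_or_card:
  assumes f: "monotone_network n f" and p: "set p \<subseteq> {1..n}"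
    and x: "x \<in> cube n" "persistent_on (set p) s f x"
  defines "y k \<equiv> update_word f (concat (replicate k p)) x"
  shows "stable_on (set p) f (y k) \<or> k \<le> card {i \<in> set p. y k i = s}"
proof (induction k)
  case 0
  show ?case by simp
next
  case (Suc k)
  have set: "set (concat (replicate k p)) \<subseteq> set p" by (auto split: if_splits)
  have y: "y k \<in> cube n" unfolding y_def
    using set p x by (intro update_word_in_cube) auto
  have per: "persistent_on (set p) s f (y k)" unfolding y_def
    by (rule persistent_update_word(1)[OF f p set x])
  have "concat (replicate (Suc k) p) = concat (replicate k p) @ p"
    by (induction k) auto
  then have step: "y (Suc k) = update_word f p (y k)"
    unfolding y_def by simp
  show ?case
  proof (cases "stable_on (set p) f (y k)")
    case True
    then show ?thesis by (simp add: step update_word_stable)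
  next
    case False
    \<comment> \<open>Persistence rules out instability at value \<open>s\<close>, so an unstable
      \<open>i\<close> lacks value \<open>s\<close> and gains it in the next sweep.\<close>
    then obtain i where i: "i \<in> set p" "f (y k) i \<noteq> y k i" by (auto simp: stable_on_def)
    then have i': "y k i \<noteq> s" "f (y k) i = s" using per by (auto simp: persistent_on_def)
    have "{i \<in> set p. y k i = s} \<subset> {i \<in> set p. y (Suc k) i = s}"
      using persistent_update_word(2,3)[OF f p subset_refl y per] i(1) i'
      unfolding step toward_def by blast
    then have "card {i \<in> set p. y k i = s} < card {i \<in> set p. y (Suc k) i = s}"
      by (intro psubset_card_mono) auto
    then show ?thesis using Suc.IH False by simp
  qed
qed

text \<open>Were the result unstable, the count would force value \<open>s\<close> on all of
  \<open>set p\<close>, and persistence then makes the configuration stable after all.\<close>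

lemma sweeps_stable:
  assumes f: "monotone_network n f" and p: "set p \<subseteq> {1..n}"
    and x: "x \<in> cube n" "persistent_on (set p) s f x"
  shows "stable_on (set p) f (update_word f (concat (replicate (length p) p)) x)"
    (is "stable_on _ _ ?y")
proof (rule ccontr)
  assume ns: "\<not> stable_on (set p) f ?y"
  then have "length p \<le> card {i \<in> set p. ?y i = s}"
    using sweeps_stable_or_card[OF f p x] by blast
  then have "{i \<in> set p. ?y i = s} = set p"
    by (intro card_seteq) (auto intro: order_trans[OF card_length])
  moreover have "persistent_on (set p) s f ?y"
    by (rule persistent_update_word(1)[OF f p _ x]) (auto split: if_splits)
  ultimately show False using ns by (auto simp: persistent_on_def stable_on_def)
qed

fun fixing_word :: "nat \<Rightarrow> nat list" where
  "fixing_word 0 = []"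
| "fixing_word (Suc m) =
    fixing_word m @ Suc m # concat (replicate (Suc m) [1..<Suc (Suc m)])"

lemma set_fixing_word: "set (fixing_word m) \<subseteq> {1..m}"
  by (induction m) (auto split: if_splits)

text \<open>The step from \<open>m\<close> to \<open>Suc m\<close> adds 1 + (m + 1)^2 letters, while
  the bound grows by 6 m^2 + 6 m + 2.\<close>

lemma length_fixing_word: "length (fixing_word m) \<le> 2 * m ^ 3"
  by (induction m) (auto simp: length_concat sum_list_replicate power3_eq_cube algebra_simps)

lemma fixing_word_stable:
  assumes f: "monotone_network n f" and x: "x \<in> cube n" and "m \<le> n"
  shows "stable_on {1..m} f (update_word f (fixing_word m) x)"
  using \<open>m \<le> n\<close>
proof (induction m)
  case 0
  show ?case by (simp add: stable_on_def)
next
  case (Suc m)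
  define y where "y = update_word f (fixing_word m) x"
  define z where "z = update f (Suc m) y"
  define s where "s = f y (Suc m)"
  define p where "p = [1..<Suc (Suc m)]"
  have p: "set p = {1..Suc m}" "length p = Suc m" by (auto simp: p_def)
  have stable: "stable_on {1..m} f y" using Suc by (simp add: y_def)
  have y: "y \<in> cube n" unfolding y_def
    using set_fixing_word[of m] Suc.prems x by (intro update_word_in_cube) auto
  have z: "z \<in> cube n" unfolding z_def
    using Suc.prems y by (intro update_in_cube) auto
  have "toward s y z" by (auto simp: toward_def z_def s_def update_def)
  then have "toward s (f y) (f z)" by (rule monotone_network_toward[OF f y z])
  \<comment> \<open>If \<open>z i = s\<close>, then \<open>f y i = s\<close>: for i \<le> m because
    \<open>y\<close> is stable there and \<open>z i = y i\<close>, for \<open>i = Suc m\<close> by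
    the choice of \<open>s\<close>.\<close>
  then have "persistent_on {1..Suc m} s f z"
    using stable unfolding persistent_on_def stable_on_def toward_def z_def s_def update_def
    by (metis atLeastAtMostSuc_conv fun_upd_apply insert_iff le_add1 plus_1_eq_Suc)
  then have "stable_on (set p) f (update_word f (concat (replicate (length p) p)) z)"
    using Suc.prems by (intro sweeps_stable[OF f _ z]) (auto simp: p)
  then show ?case
    unfolding p by (simp add: z_def y_def p_def del: upt_Suc replicate.simps)
qed

lemma fixing_word_fixes:
  assumes f: "monotone_network n f"
  shows "fixes_network n (fixing_word n) f"
  unfolding fixes_network_def
proof
  fix x assume x: "x \<in> cube n"
  let ?y = "update_word f (fixing_word n) x"
  have y: "?y \<in> cube n" by (rule update_word_in_cube[OF set_fixing_word x])
  then have "f ?y \<in> cube n" using f by (auto simp: monotone_network_def network_def)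
  \<comment> \<open>Stability covers components 1 to n only; off these, both sides are
    \<open>undefined\<close>, as both lie in the cube.\<close>
  then show "f ?y = ?y"
    using y fixing_word_stable[OF f x order_refl] unfolding cube_def stable_on_def
    by (intro PiE_ext) auto
qed

theorem theorem4:
  shows "\<exists>C::real. C > 0 \<and>
    (\<forall>n::nat. n \<ge> 1 \<longrightarrow>
      (\<exists>w. set w \<subseteq> {1..n} \<and> real (length w) \<le> C * real n ^ 3 \<and>
        (\<forall>f. monotone_network n f \<longrightarrow> fixes_network n w f)))"
proof (intro exI[of _ 2] conjI allI impI)
  fix n :: nat
  have "real (length (fixing_word n)) \<le> real (2 * n ^ 3)"
    using length_fixing_word of_nat_le_iff by blast
  then show "\<exists>w. set w \<subseteq> {1..n} \<and> real (length w) \<le> 2 * real n ^ 3 \<and>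
      (\<forall>f. monotone_network n f \<longrightarrow> fixes_network n w f)"
    using set_fixing_word fixing_word_fixes by (intro exI[of _ "fixing_word n"]) auto
qed simp

end
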